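(* Let $O\subseteq\mathbb{R}^m$ be nonempty, open and convex, let $f,g:O\to\mathbb{R}$ be continuous convex functions, and let $X\subseteq O$ be a nonempty compact convex set that is not a singleton. Assume that the problem $(P)$: $\min\{f(x): g(x)\le 0,\ x\in X\}$ has a nonempty set of optimal solutions, with optimal value $f_{\rm opt}$, and that lower-$\mathcal{C}^2$ representations $f=\max_{t\in T_f}f_t$ and $g=\max_{t\in T_g}g_t$ are given on an open set $O'$ with $X\subseteq O'\subseteq O$. Let $\varepsilon>0$ and let $(x_k)_{k\in\mathbb{N}}$ be a sequence generated by the Derivative-Free $\varepsilon$-CoMirror algorithm described in the context. For $n\in\mathbb{N}$ put $I_n^{\varepsilon}=\{k\in\{1,\ldots,n\}: g(x_k)\le\varepsilon\}$. Then for every integer $n\ge 4$, $$\min\left\{\min_{k\in I_n^{\varepsilon}}\bigl(f(x_k)-f_{\rm opt}\bigr),\ \varepsilon\right\}\le\frac{C}{\sqrt n},$$ where $$C=2\sqrt{\frac{\Theta}{\alpha}}\,\max\{\kappa_1,\kappa_2\}\,\frac{1+\ln 2}{2-\sqrt2}+\sqrt2\,\kappa_2\,\Omega,$$ $$\kappa_1=\max\{L_f,L_g\},\qquad \kappa_2=K\left(1+\tfrac{\sqrt m\,M}{2}\right),\qquad \Omega=\max_{x,y\in X}|x-y|,$$ $L_f=\sup\{|v|: v\in\partial f(x),\,x\in X\}$, $L_g=\sup\{|v|: v\in\partial g(x),\,x\in X\}$, $K=\max\{K_f,K_g\}$, and $M>0$ is the algorithm's bound $|\hat L_k^{-1}|\le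 M$ for all $k\in\{1,2,\ldots\}$. A minimum over the empty set is $+\infty$.
   Context: $|\cdot|$ is the Euclidean norm on $\mathbb{R}^m$ and the spectral norm on matrices; $B(x;\Delta)$ is the closed ball; $\mathbb{N}=\{1,2,\ldots\}$. For convex $f:O\to\mathbb{R}$, $\partial f(x)=\{v: f(y)\ge f(x)+\langle v,y-x\rangle\ \text{for all } y\in O\}$. Lower-$\mathcal{C}^2$ representation of $f$ on $O'$: $f=\max_{t\in T_f}f_t$ on $O'$, where $T_f$ is a compact topological space, each $f_t$ is $\mathcal{C}^2$ on $O'$, and $(t,x)\mapsto f_t(x),\nabla f_t(x),\nabla^2f_t(x)$ are continuous on $T_f\times O'$ (similarly for $g$). $K_f,K_g\ge0$ are constants such that $\nabla f_t$ is $K_f$-Lipschitz on $O'$ for every $t\in T_f$ and $\nabla g_t$ is $K_g$-Lipschitz on $O'$ for every $t\in T_g$. $A_f(x)=\operatorname{argmax}_{t\in T_f}f_t(x)$, $A_g(x)=\operatorname{argmax}_{t\in T_g}g_t(x)$. Poised tuple: $Y=(y_0,\ldots,y_m)$, $y_i\in\mathbb{R}^m$, is poised centred at $y_0$ if the $(m+1)\times(m+1)$ matrix with rows $(1,y_i^{\top})$, $i=0,\ldots,m$, is invertible. The linear interpolation model over $Y$ of a function $h$ is the unique affine $H:\mathbb{R}^m\to\mathbb{R}$ with $H(y_i)=h(y_i)$ for all $i$. With $\Delta(Y)=\max_{1\le i\le m}|y_i-y_0|$, let $\hat L(Y)=\frac{1}{\Delta(Y)}L(Y)$, where $L(Y)$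 is the $m\times m$ matrix with rows $(y_i-y_0)^{\top}$, $i=1,\ldots,m$. Bregman data: $\omega:O\to\mathbb{R}$ is differentiable and strongly convex with parameter $\alpha>0$, i.e. $\omega(tx+(1-t)y)\le t\omega(x)+(1-t)\omega(y)-\frac{\alpha}{2}t(1-t)|x-y|^2$ for $x,y\in O$, $t\in[0,1]$; $D_\omega(u,v)=\omega(u)-\omega(v)-\langle\nabla\omega(v),u-v\rangle$; $\Theta=\sup\{D_\omega(u,v):u,v\in X\}$ (Bregman diameter of $X$). Derivative-Free $\varepsilon$-CoMirror algorithm. Input: a starting point in $X$ and $M>0$. All iterates lie in $X$. For every $k\in\{1,2,\ldots\}$: (1) select $0<\Delta_k\le\frac{1}{\sqrt{k+1}}$; (2) select a poised tuple $Y_k=(y_0,\ldots,y_m)$ (depending on $k$) centred at $y_0=x_k$ with $\{y_0,\ldots,y_m\}\subseteq B(x_k;\Delta_k)$ and $|\hat L_k^{-1}|\le M$, where $\hat L_k=\hat L(Y_k)$; it is required that $B(x_k;\Delta(Y_k))\subseteq O'$; (3) set $E_k=V_f(x_k)$ if $g(x_k)\le\varepsilon$ and $E_k=V_g(x_k)$ otherwise. Here $V_f(x_k)=\sum_{i=1}^r\lambda_i\nabla F_{t_i}(x_k)$ for some $r\in\mathbb{N}$, $t_1,\ldots,t_r\in A_f(x_k)$ and convex weights $\lambda_i\in[0,1]$, $\sum_i\lambda_i=1$, with $F_t$ the linear interpolation model of $f_t$ over $Y_k$; $V_g(x_k)$ is defined in the same way from $A_g(x_k)$ and the linear interpolation models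 $G_t$ of $g_t$ over $Y_k$. It is assumed that $E_k\ne0$ for all $k$; (4) set $t_k=\frac{\sqrt{\Theta\alpha}}{|E_k|\sqrt k}$ and $x_{k+1}=\operatorname{argmin}_{x\in X}\{\langle t_kE_k-\nabla\omega(x_k),x\rangle+\omega(x)\}$ (a unique minimizer). *)

theory Defs
  imports "HOL-Analysis.Analysis"
begin

section \<open>Convex analysis and lower-\<open>C\<^sup>2\<close> representations\<close>

definition gradient :: "('a::real_inner \<Rightarrow> real) \<Rightarrow> 'a \<Rightarrow> 'a" where
  "gradient h x = (THE v. GDERIV h x :> v)"

definition hessian :: "(real ^ 'm \<Rightarrow> real) \<Rightarrow> real ^ 'm \<Rightarrow> real ^ 'm ^ 'm" where
  "hessian h x = jacobian (gradient h) (at x)"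

text \<open>Meant for open \<open>S\<close>. Continuity of \<open>h\<close> and of its gradient follows from differentiability.\<close>

definition C2_on :: "(real ^ 'm) set \<Rightarrow> (real ^ 'm \<Rightarrow> real) \<Rightarrow> bool" where
  "C2_on S h \<longleftrightarrow>
     (\<forall>x\<in>S. h differentiable (at x) \<and> gradient h differentiable (at x)) \<and>
     continuous_on S (hessian h)"

definition subdifferential :: "'a::real_inner set \<Rightarrow> ('a \<Rightarrow> real) \<Rightarrow> 'a \<Rightarrow> 'a set" where
  "subdifferential U f x = {v. \<forall>y\<in>U. f y \<ge> f x + v \<bullet> (y - x)}"

text \<open>\<open>L\<^sub>f = sup {|v| : v \<in> \<partial>f(x), x \<in> X}\<close>. The set is nonempty and bounded for a continuous convex
  \<open>f\<close> on an open \<open>U\<close> and a nonempty compact \<open>X \<subseteq> U\<close>, so the real supremum is the true one.\<close>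

definition subgradient_bound :: "'a::real_inner set \<Rightarrow> 'a set \<Rightarrow> ('a \<Rightarrow> real) \<Rightarrow> real" where
  "subgradient_bound U X f = Sup {norm v | v x. x \<in> X \<and> v \<in> subdifferential U f x}"

definition lower_C2_representation ::
    "(real ^ 'm) set \<Rightarrow> (real ^ 'm \<Rightarrow> real) \<Rightarrow> 't topology \<Rightarrow> ('t \<Rightarrow> real ^ 'm \<Rightarrow> real) \<Rightarrow> bool" where
  "lower_C2_representation U' f T F \<longleftrightarrow>
     compact_space T \<and>
     (\<forall>x\<in>U'. f x \<in> (\<lambda>t. F t x) ` topspace T \<and> (\<forall>t\<in>topspace T. F t x \<le> f x)) \<and>
     (\<forall>t\<in>topspace T. C2_on U' (F t)) \<and>
     continuous_map (prod_topology T (top_of_set U')) euclidean (\<lambda>(t, x). F t x) \<and>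
     continuous_map (prod_topology T (top_of_set U')) euclidean (\<lambda>(t, x). gradient (F t) x) \<and>
     continuous_map (prod_topology T (top_of_set U')) euclidean (\<lambda>(t, x). hessian (F t) x)"

definition active_set :: "'t topology \<Rightarrow> ('t \<Rightarrow> 'a \<Rightarrow> real) \<Rightarrow> 'a \<Rightarrow> 't set" where
  "active_set T F x = {t. is_arg_max (\<lambda>t. F t x) (\<lambda>t. t \<in> topspace T) t}"


section \<open>Linear interpolation\<close>

text \<open>A tuple \<open>(y\<^sub>0, \<dots>, y\<^sub>m)\<close> in \<open>\<real>\<^sup>m\<close> is a function on \<open>'m option\<close>, where \<open>'m\<close> is the index type of
  the coordinates: \<open>None\<close> is the index 0 and \<open>Some i\<close> are the indices 1 to \<open>m = CARD('m)\<close>. The same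
  encoding indexes the columns \<open>(1, y\<^sup>T)\<close> of the matrix in the definition of poisedness.\<close>

definition interpolation_matrix ::
    "('m::finite option \<Rightarrow> real ^ 'm) \<Rightarrow> real ^ ('m option) ^ ('m option)" where
  "interpolation_matrix Y = (\<chi> i j. case j of None \<Rightarrow> 1 | Some l \<Rightarrow> Y i $ l)"

definition poised :: "('m::finite option \<Rightarrow> real ^ 'm) \<Rightarrow> bool" where
  "poised Y \<longleftrightarrow> invertible (interpolation_matrix Y)"

definition tuple_radius :: "('m::finite option \<Rightarrow> real ^ 'm) \<Rightarrow> real" where
  "tuple_radius Y = Max (range (\<lambda>i. norm (Y (Some i) - Y None)))"

definition L_matrix :: "('m::finite option \<Rightarrow> real ^ 'm) \<Rightarrow> real ^ 'm ^ 'm" where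
  "L_matrix Y = (\<chi> i. Y (Some i) - Y None)"

definition L_hat :: "('m::finite option \<Rightarrow> real ^ 'm) \<Rightarrow> real ^ 'm ^ 'm" where
  "L_hat Y = (1 / tuple_radius Y) *\<^sub>R L_matrix Y"

text \<open>The norm that the matrix type inherits as a Euclidean space is the Frobenius norm, hence the
  operator norm.\<close>

definition spectral_norm :: "real ^ 'm ^ 'n \<Rightarrow> real" where
  "spectral_norm A = onorm ((*v) A)"

definition affine_function :: "('a::real_inner \<Rightarrow> real) \<Rightarrow> bool" where
  "affine_function H \<longleftrightarrow> (\<exists>a c. \<forall>x. H x = a + c \<bullet> x)"

definition linear_model ::
    "('m::finite option \<Rightarrow> real ^ 'm) \<Rightarrow> (real ^ 'm \<Rightarrow> real) \<Rightarrow> real ^ 'm \<Rightarrow> real" where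
  "linear_model Y h = (THE H. affine_function H \<and> (\<forall>i. H (Y i) = h (Y i)))"

text \<open>All admissible choices of \<open>V\<^sub>f(x)\<close>.\<close>

definition model_subgradients ::
    "'t topology \<Rightarrow> ('t \<Rightarrow> real ^ 'm \<Rightarrow> real) \<Rightarrow> ('m::finite option \<Rightarrow> real ^ 'm) \<Rightarrow> real ^ 'm \<Rightarrow>
     (real ^ 'm) set" where
  "model_subgradients T F Y x =
     {V. \<exists>(r::nat) (\<tau> :: nat \<Rightarrow> 't) (\<mu> :: nat \<Rightarrow> real).
           r \<ge> 1 \<and>
           (\<forall>i\<in>{1..r}. \<tau> i \<in> active_set T F x \<and> 0 \<le> \<mu> i \<and> \<mu> i \<le> 1) \<and>
           (\<Sum>i=1..r. \<mu> i) = 1 \<and>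
           V = (\<Sum>i=1..r. \<mu> i *\<^sub>R gradient (linear_model Y (F (\<tau> i))) x)}"


section \<open>Bregman distances\<close>

definition strongly_convex_on :: "'a::real_inner set \<Rightarrow> real \<Rightarrow> ('a \<Rightarrow> real) \<Rightarrow> bool" where
  "strongly_convex_on U \<alpha> \<omega> \<longleftrightarrow>
     (\<forall>x\<in>U. \<forall>y\<in>U. \<forall>t\<in>{0..1}.
        \<omega> (t *\<^sub>R x + (1 - t) *\<^sub>R y)
          \<le> t * \<omega> x + (1 - t) * \<omega> y - \<alpha> / 2 * t * (1 - t) * (norm (x - y))\<^sup>2)"

definition bregman :: "('a::real_inner \<Rightarrow> real) \<Rightarrow> 'a \<Rightarrow> 'a \<Rightarrow> real" where
  "bregman \<omega> u v = \<omega> u - \<omega> v - gradient \<omega> v \<bullet> (u - v)"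

text \<open>For differentiable convex \<open>\<omega>\<close> on an open convex set around a compact \<open>X\<close> the supremum is finite.\<close>

definition bregman_diameter :: "('a::real_inner \<Rightarrow> real) \<Rightarrow> 'a set \<Rightarrow> real" where
  "bregman_diameter \<omega> X = Sup {bregman \<omega> u v | u v. u \<in> X \<and> v \<in> X}"


section \<open>The optimization problem and the algorithm\<close>

definition feasible_set :: "'a set \<Rightarrow> ('a \<Rightarrow> real) \<Rightarrow> 'a set" where
  "feasible_set X g = {x \<in> X. g x \<le> 0}"

definition optimal_solutions :: "'a set \<Rightarrow> ('a \<Rightarrow> real) \<Rightarrow> ('a \<Rightarrow> real) \<Rightarrow> 'a set" where
  "optimal_solutions X f g = {x. is_arg_min f (\<lambda>x. x \<in> feasible_set X g) x}"

definition optimal_value :: "'a set \<Rightarrow> ('a \<Rightarrow> real) \<Rightarrow> ('a \<Rightarrow> real) \<Rightarrow> real" where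
  "optimal_value X f g = (INF x\<in>feasible_set X g. f x)"

text \<open>\<open>x\<close> is a sequence generated by the algorithm for some admissible radii \<open>\<Delta>\<^sub>k\<close>, tuples \<open>Y\<^sub>k\<close> and
  directions \<open>E\<^sub>k \<noteq> 0\<close>. The iterates are \<open>x 1, x 2, \<dots>\<close>; the value \<open>x 0\<close> plays no role.\<close>

definition comirror_sequence ::
    "(real ^ 'm) set \<Rightarrow> (real ^ 'm) set \<Rightarrow> (real ^ 'm \<Rightarrow> real) \<Rightarrow>
     's topology \<Rightarrow> ('s \<Rightarrow> real ^ 'm \<Rightarrow> real) \<Rightarrow> 't topology \<Rightarrow> ('t \<Rightarrow> real ^ 'm \<Rightarrow> real) \<Rightarrow>
     (real ^ 'm \<Rightarrow> real) \<Rightarrow> real \<Rightarrow> real \<Rightarrow> real \<Rightarrow> (nat \<Rightarrow> real ^ ('m::finite)) \<Rightarrow> bool" where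
  "comirror_sequence U' X g T\<^sub>f F T\<^sub>g G \<omega> \<alpha> \<epsilon> M x \<longleftrightarrow>
     (\<forall>k\<ge>1. x k \<in> X) \<and>
     (\<exists>(\<Delta> :: nat \<Rightarrow> real) (Y :: nat \<Rightarrow> 'm option \<Rightarrow> real ^ 'm) (E :: nat \<Rightarrow> real ^ 'm).
        \<forall>k\<ge>1.
          0 < \<Delta> k \<and> \<Delta> k \<le> 1 / sqrt (real k + 1) \<and>
          poised (Y k) \<and> Y k None = x k \<and> range (Y k) \<subseteq> cball (x k) (\<Delta> k) \<and>
          spectral_norm (matrix_inv (L_hat (Y k))) \<le> M \<and>
          cball (x k) (tuple_radius (Y k)) \<subseteq> U' \<and>
          E k \<in> (if g (x k) \<le> \<epsilon> then model_subgradients T\<^sub>f F (Y k) (x k)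
                 else model_subgradients T\<^sub>g G (Y k) (x k)) \<and>
          E k \<noteq> 0 \<and>
          (let t = sqrt (bregman_diameter \<omega> X * \<alpha>) / (norm (E k) * sqrt (real k))
           in is_arg_min (\<lambda>z. (t *\<^sub>R E k - gradient \<omega> (x k)) \<bullet> z + \<omega> z) (\<lambda>z. z \<in> X)
                (x (k + 1))))"

end

theory Submission
  imports Defs
begin

text \<open>The gradient of an active \<open>f\<^sub>t\<close> at \<open>x\<^sub>k\<close> is a subgradient of \<open>f\<close>, and the linear model of \<open>f\<^sub>t\<close>
  over a poised tuple reproduces it up to \<open>\<kappa>\<^sub>2 \<Delta>\<^sub>k\<close>; hence \<open>E\<^sub>k\<close> is within \<open>\<kappa>\<^sub>2 / sqrt (k + 1)\<close> of a
  true subgradient of \<open>f\<close> or of \<open>g\<close>. The mirror step is the usual inexact mirror descent step,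
  whose inequality telescopes. Summing only over \<open>n / 2 \<le> k \<le> n\<close> keeps the harmonic sum bounded,
  while the step lengths still add up to order \<open>sqrt n\<close>, so no logarithm appears in the rate: some
  such \<open>k\<close> has \<open>E\<^sub>k \<bullet> (x\<^sub>k - u) = O(1 / sqrt n)\<close> for the optimal solution \<open>u\<close>. This bounds
  \<open>f(x\<^sub>k) - f(u)\<close> if \<open>g(x\<^sub>k) \<le> \<epsilon>\<close>, and \<open>\<epsilon> < g(x\<^sub>k) - g(u)\<close> otherwise.\<close>

section \<open>Gradients and difference quotients\<close>

lemma gderiv_unique: "GDERIV h x :> v \<Longrightarrow> GDERIV h x :> w \<Longrightarrow> v = w"
  unfolding gderiv_def by (metis has_derivative_unique vector_eq_ldot)

lemma gradient_eqI: "GDERIV h x :> v \<Longrightarrow> gradient h x = v"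
  unfolding gradient_def using gderiv_unique by blast

text \<open>The vector \<open>adjoint D 1\<close> is the Riesz representative of the functional
  \<open>D\<close>, so the description in \<open>gradient\<close> denotes an actual gradient
  wherever the function is differentiable.\<close>

lemma GDERIV_gradient:
  fixes x :: "'a::euclidean_space"
  assumes "h differentiable (at x)"
  shows "GDERIV h x :> gradient h x"
proof -
  obtain D where D: "(h has_derivative D) (at x)"
    using assms by (auto simp: differentiable_def)
  have "D = (\<lambda>z. z \<bullet> adjoint D 1)"
    using adjoint_works[OF has_derivative_linear[OF D], of _ 1] by auto
  with D have "GDERIV h x :> adjoint D 1"
    unfolding gderiv_def by metis
  then show ?thesis using gradient_eqI by metis
qed

lemma gradient_affine: "gradient (\<lambda>z. a + c \<bullet> z) x = c"
  by (rule gradient_eqI) (auto simp: gderiv_def inner_commute intro!: derivative_eq_intros)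

lemma GDERIV_along_line:
  assumes "GDERIV h (x + s *\<^sub>R d) :> v"
  shows "((\<lambda>s. h (x + s *\<^sub>R d)) has_real_derivative v \<bullet> d) (at s)"
proof -
  have "((\<lambda>s. x + s *\<^sub>R d) has_derivative (\<lambda>r. r *\<^sub>R d)) (at s)"
    by (auto intro!: derivative_eq_intros)
  then have "((\<lambda>s. h (x + s *\<^sub>R d)) has_derivative (\<lambda>r. (r *\<^sub>R d) \<bullet> v)) (at s)"
    using assms unfolding gderiv_def by (rule has_derivative_compose)
  then show ?thesis
    unfolding has_field_derivative_def by (simp add: inner_commute mult_commute_abs)
qed

text \<open>One-sided first-order comparison; the quadratic slack absorbs the strong convexity term in
  \<open>bregman_ge\<close>.\<close>

lemma GDERIV_inner_le:
  assumes h: "GDERIV h x :> v"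
    and le: "eventually (\<lambda>s. h (x + s *\<^sub>R d) \<le> h x + s * b + s\<^sup>2 * q) (at_right 0)"
  shows "v \<bullet> d \<le> b"
proof (rule tendsto_le)
  show "((\<lambda>s. (h (x + s *\<^sub>R d) - h x) / s) \<longlongrightarrow> v \<bullet> d) (at_right 0)"
    using GDERIV_along_line[of h x 0 d v] h
    by (auto simp: has_field_derivative_iff intro: tendsto_within_subset)
  show "((\<lambda>s. b + s * q) \<longlongrightarrow> b) (at_right 0)"
    by (auto intro!: tendsto_eq_intros)
  show "eventually (\<lambda>s. (h (x + s *\<^sub>R d) - h x) / s \<le> b + s * q) (at_right 0)"
    using le eventually_at_right_less
  proof eventually_elim
    case (elim s)
    then show ?case by (simp add: divide_le_eq algebra_simps power2_eq_square)
  qed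
qed simp

lemma eventually_at_right_in_unit: "eventually (\<lambda>s::real. 0 < s \<and> s < 1) (at_right 0)"
  by (auto simp: eventually_at_right_field intro!: exI[of _ 1])

section \<open>Subgradients of convex functions\<close>

lemma convex_combination_in_subdifferential:
  assumes "\<And>i. i \<in> I \<Longrightarrow> v i \<in> subdifferential U f x"
    and "\<And>i. i \<in> I \<Longrightarrow> 0 \<le> \<mu> i" "sum \<mu> I = 1"
  shows "(\<Sum>i\<in>I. \<mu> i *\<^sub>R v i) \<in> subdifferential U f x"
  unfolding subdifferential_def
proof clarify
  fix y assume "y \<in> U"
  have "f x + (\<Sum>i\<in>I. \<mu> i *\<^sub>R v i) \<bullet> (y - x) = (\<Sum>i\<in>I. \<mu> i * (f x + v i \<bullet> (y - x)))"
    using assms(3) by (simp add: inner_sum_left distrib_left sum.distrib flip: sum_distrib_right)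
  also have "\<dots> \<le> (\<Sum>i\<in>I. \<mu> i * f y)"
    using assms \<open>y \<in> U\<close> by (auto simp: subdifferential_def intro!: sum_mono mult_left_mono)
  also have "\<dots> = f y" using assms(3) by (simp flip: sum_distrib_right)
  finally show "f x + (\<Sum>i\<in>I. \<mu> i *\<^sub>R v i) \<bullet> (y - x) \<le> f y" .
qed

text \<open>On the segment from \<open>x\<close> to \<open>y\<close>, \<open>h\<close> stays below
  \<open>f\<close> near \<open>x\<close> and \<open>f\<close> stays below its chord, with equality
  at \<open>x\<close>. The slope of \<open>h\<close> is therefore at most that of the chord. The
  choice \<open>h = f\<close> covers a differentiable convex function.\<close>

lemma gradient_minorant_in_subdifferential:
  assumes f: "convex_on U f" and x: "x \<in> U" and h: "GDERIV h x :> v"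
    and le: "eventually (\<lambda>z. h z \<le> f z) (nhds x)" and eq: "h x = f x"
  shows "v \<in> subdifferential U f x"
  unfolding subdifferential_def
proof clarify
  fix y assume y: "y \<in> U"
  have "filterlim (\<lambda>s. x + s *\<^sub>R (y - x)) (nhds x) (at_right 0)"
    by (auto intro!: tendsto_eq_intros)
  then have "eventually (\<lambda>s. h (x + s *\<^sub>R (y - x)) \<le> f (x + s *\<^sub>R (y - x))) (at_right 0)"
    by (rule eventually_compose_filterlim[OF le])
  with eventually_at_right_in_unit
  have "eventually (\<lambda>s. h (x + s *\<^sub>R (y - x)) \<le> h x + s * (f y - f x) + s\<^sup>2 * 0) (at_right 0)"
  proof eventually_elim
    case (elim s)
    then have "f ((1 - s) *\<^sub>R x + s *\<^sub>R y) \<le> (1 - s) * f x + s * f y"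
      using convex_onD[OF f, of s x y] x y by auto
    with elim show ?case by (simp add: algebra_simps eq)
  qed
  then have "v \<bullet> (y - x) \<le> f y - f x" by (rule GDERIV_inner_le[OF h])
  then show "f x + v \<bullet> (y - x) \<le> f y" by simp
qed

text \<open>The subgradient inequality, tested at distance \<open>e\<close> from \<open>x\<close> in
  the direction of \<open>v\<close>, gives e |v| <= f y - f x. The right side is bounded because
  \<open>f\<close> is bounded on the compact \<open>e\<close>-neighbourhood \<open>S\<close> of
  \<open>X\<close>, which still lies in \<open>U\<close>.\<close>

lemma subdifferential_bounded_on_compact:
  fixes U :: "'a::euclidean_space set"
  assumes "open U" "continuous_on U f" "compact X" "X \<subseteq> U"
  obtains B where "\<And>x v. x \<in> X \<Longrightarrow> v \<in> subdifferential U f x \<Longrightarrow> norm v \<le> B"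
proof -
  obtain e where e: "e > 0" "(\<Union>x\<in>X. cball x e) \<subseteq> U"
    using compact_subset_open_imp_cball_epsilon_subset[OF assms(3,1,4)] by blast
  define S where "S = {x + y | x y. x \<in> X \<and> y \<in> cball 0 e}"
  have "S \<subseteq> U"
  proof
    fix z assume "z \<in> S"
    then obtain x y where "z = x + y" "x \<in> X" "norm y \<le> e" by (auto simp: S_def)
    then have "x \<in> X" "z \<in> cball x e" by (auto simp: dist_norm)
    then show "z \<in> U" using e(2) by blast
  qed
  moreover have "compact S"
    unfolding S_def by (rule compact_sums[OF assms(3) compact_cball])
  ultimately have "bounded (f ` S)"
    by (intro compact_imp_bounded compact_continuous_image continuous_on_subset[OF assms(2)])
  then obtain B where B: "\<And>z. z \<in> S \<Longrightarrow> \<bar>f z\<bar> \<le> B"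
    by (auto simp: bounded_iff)
  show ?thesis
  proof (rule that[of "2 * B / e"])
    fix x v assume x: "x \<in> X" and v: "v \<in> subdifferential U f x"
    define y where "y = x + e *\<^sub>R sgn v"
    have "x + 0 \<in> S" unfolding S_def using x e(1) by fastforce
    then have "x \<in> S" by simp
    have "norm (e *\<^sub>R sgn v) \<le> e" using e(1) by (simp add: norm_sgn)
    then have "y \<in> S" unfolding S_def y_def using x mem_cball_0 by blast
    have "f x + v \<bullet> (y - x) \<le> f y"
      using v \<open>y \<in> S\<close> \<open>S \<subseteq> U\<close> by (auto simp: subdifferential_def)
    moreover have "v \<bullet> (y - x) = e * norm v"
      by (cases "v = 0") (simp_all add: y_def sgn_div_norm dot_square_norm power2_eq_square)
    ultimately show "norm v \<le> 2 * B / e"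
      using B[OF \<open>x \<in> S\<close>] B[OF \<open>y \<in> S\<close>] e(1) by (simp add: field_simps)
  qed
qed

text \<open>A real \<open>Sup\<close> is known to dominate its set only when the set is bounded
  above, which compactness of \<open>X\<close> supplies.\<close>

lemma norm_le_subgradient_bound:
  fixes U :: "'a::euclidean_space set"
  assumes "open U" "continuous_on U f" "compact X" "X \<subseteq> U"
    and "x \<in> X" "v \<in> subdifferential U f x"
  shows "norm v \<le> subgradient_bound U X f"
proof -
  obtain B where "\<And>x v. x \<in> X \<Longrightarrow> v \<in> subdifferential U f x \<Longrightarrow> norm v \<le> B"
    using subdifferential_bounded_on_compact[OF assms(1-4)] by blast
  then show ?thesis
    unfolding subgradient_bound_def using assms(5,6)
    by (intro cSup_upper) (auto intro!: bdd_aboveI[of _ B])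
qed

section \<open>Linearization and the error of linear interpolation\<close>

lemma lipschitz_gradient_linearization:
  assumes "convex S" "x \<in> S" "y \<in> S"
    and h: "\<And>z. z \<in> S \<Longrightarrow> GDERIV h z :> h' z"
    and lip: "K-lipschitz_on S h'"
  shows "\<bar>h y - h x - h' x \<bullet> (y - x)\<bar> \<le> K / 2 * (norm (y - x))\<^sup>2"
proof -
  define d where "d = y - x"
  have line: "x + s *\<^sub>R d \<in> S" if "0 \<le> s" "s \<le> 1" for s
    using convexD_alt[OF assms(1-3) that] by (simp add: d_def algebra_simps)
  have slope: "\<bar>(h' (x + s *\<^sub>R d) - h' x) \<bullet> d\<bar> \<le> K * s * (norm d)\<^sup>2" if "0 \<le> s" "s \<le> 1" for s
  proof -
    have "\<bar>(h' (x + s *\<^sub>R d) - h' x) \<bullet> d\<bar> \<le> norm (h' (x + s *\<^sub>R d) - h' x) * norm d"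
      by (rule Cauchy_Schwarz_ineq2)
    also have "\<dots> \<le> (K * (s * norm d)) * norm d"
      using lipschitz_onD[OF lip line[OF that] assms(2)] that
      by (intro mult_right_mono) (auto simp: dist_norm)
    finally show ?thesis by (simp add: power2_eq_square mult.assoc)
  qed
  have bound: "c * (h y - h x - h' x \<bullet> d) \<le> K / 2 * (norm d)\<^sup>2" if c: "c = 1 \<or> c = -1" for c
  proof -
    \<comment> \<open>The two values of \<open>c\<close> treat the two signs of the remainder. The
      subtracted quadratic has derivative \<open>K * s * (norm d)\<^sup>2\<close>, exactly the bound
      in \<open>slope\<close>, so \<open>\<phi>\<close> is nonincreasing on [0, 1].\<close>
    define \<phi> where "\<phi> s = c * (h (x + s *\<^sub>R d) - s * (h' x \<bullet> d)) - K / 2 * s\<^sup>2 * (norm d)\<^sup>2" for s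
    have "\<phi> 1 \<le> \<phi> 0"
    proof (rule DERIV_nonpos_imp_nonincreasing[where f = \<phi>])
      fix s :: real assume s: "0 \<le> s" "s \<le> 1"
      have "(\<phi> has_real_derivative
          c * (h' (x + s *\<^sub>R d) \<bullet> d - h' x \<bullet> d) - K * s * (norm d)\<^sup>2) (at s)"
        unfolding \<phi>_def
        using GDERIV_along_line[OF h[OF line[OF s]]] by (auto intro!: derivative_eq_intros)
      moreover have "c * (h' (x + s *\<^sub>R d) \<bullet> d - h' x \<bullet> d) - K * s * (norm d)\<^sup>2 \<le> 0"
        using slope[OF s] c by (auto simp: inner_diff_left)
      ultimately show "\<exists>D. (\<phi> has_real_derivative D) (at s) \<and> D \<le> 0" by blast
    qed simp
    then show ?thesis by (simp add: \<phi>_def d_def algebra_simps)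
  qed
  show ?thesis using bound[of 1] bound[of "-1"] unfolding abs_le_iff d_def by simp
qed

text \<open>In other words, the differences span the space. This consequence of poisedness yields
  uniqueness of the interpolant, a positive radius and injectivity of
  \<open>L_hat Y\<close>.\<close>

lemma poised_imp_differences_ker:
  fixes Y :: "'m::finite option \<Rightarrow> real ^ 'm"
  assumes "poised Y" and w: "\<And>i. w \<bullet> (Y (Some i) - Y None) = 0"
  shows "w = 0"
proof -
  \<comment> \<open>\<open>z\<close> collects the coefficients of the affine function \<open>w \<bullet> (y - Y None)\<close>, which vanishes on \<open>Y\<close>.\<close>
  define z :: "real ^ 'm option" where "z = (\<chi> j. case j of None \<Rightarrow> - (w \<bullet> Y None) | Some l \<Rightarrow> w $ l)"
  have w': "w \<bullet> Y i = w \<bullet> Y None" for i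
    using w by (cases i) (auto simp: inner_diff_right)
  have "(interpolation_matrix Y *v z) $ i = 0" for i
    using w'[of i]
    by (simp add: matrix_vector_mult_def interpolation_matrix_def z_def UNIV_option_conv
        sum.reindex inner_vec_def mult.commute)
  then have "interpolation_matrix Y *v z = 0" by (simp add: vec_eq_iff)
  then have "z = 0"
    using assms(1) matrix_left_invertible_ker invertible_def unfolding poised_def by blast
  then have "w $ l = 0" for l
    by (auto simp: z_def vec_eq_iff dest: spec[of _ "Some l"])
  then show ?thesis by (simp add: vec_eq_iff)
qed

text \<open>Solving the linear system gives the coefficients. The slopes of two affine interpolants
  have the same inner product with every difference, hence coincide. So the description in
  \<open>linear_model\<close> denotes an explicit affine function, whose gradient can be read
  off.\<close>

lemma poised_interpolant:
  fixes Y :: "'m::finite option \<Rightarrow> real ^ 'm"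
  assumes "poised Y"
  obtains a c where "\<And>i. a + c \<bullet> Y i = h (Y i)" "linear_model Y h = (\<lambda>z. a + c \<bullet> z)"
proof -
  obtain B where B: "interpolation_matrix Y ** B = mat 1"
    using assms unfolding poised_def invertible_def by blast
  define z where "z = B *v (\<chi> i. h (Y i))"
  define a where "a = z $ None"
  define c :: "real ^ 'm" where "c = (\<chi> l. z $ Some l)"
  have "interpolation_matrix Y *v z = (\<chi> i. h (Y i))"
    using B by (simp add: z_def matrix_vector_mul_assoc)
  then have "(interpolation_matrix Y *v z) $ i = h (Y i)" for i by simp
  then have ac: "a + c \<bullet> Y i = h (Y i)" for i
    by (simp add: matrix_vector_mult_def interpolation_matrix_def a_def c_def UNIV_option_conv
        sum.reindex inner_vec_def mult.commute)
  have "linear_model Y h = (\<lambda>z. a + c \<bullet> z)"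
    unfolding linear_model_def
  proof (rule the_equality)
    show "affine_function (\<lambda>z. a + c \<bullet> z) \<and> (\<forall>i. a + c \<bullet> Y i = h (Y i))"
      using ac by (auto simp: affine_function_def)
  next
    fix H assume H: "affine_function H \<and> (\<forall>i. H (Y i) = h (Y i))"
    then obtain a' c' where H': "\<And>z. H z = a' + c' \<bullet> z" unfolding affine_function_def by blast
    with H have ac': "a' + c' \<bullet> Y i = h (Y i)" for i by metis
    have "c' - c = 0"
    proof (rule poised_imp_differences_ker[OF assms])
      fix i show "(c' - c) \<bullet> (Y (Some i) - Y None) = 0"
        using ac[of "Some i"] ac[of None] ac'[of "Some i"] ac'[of None]
        by (simp add: inner_diff_left inner_diff_right)
    qed
    with ac[of None] ac'[of None] show "H = (\<lambda>z. a + c \<bullet> z)" by (auto simp: H')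
  qed
  with ac that show ?thesis by blast
qed

lemma norm_diff_le_tuple_radius: "norm (Y (Some i) - Y None) \<le> tuple_radius Y"
  unfolding tuple_radius_def by (rule Max_ge) auto

lemma poised_tuple_radius_pos:
  fixes Y :: "'m::finite option \<Rightarrow> real ^ 'm"
  assumes "poised Y"
  shows "tuple_radius Y > 0"
proof (rule ccontr)
  assume "\<not> tuple_radius Y > 0"
  then have "Y (Some i) - Y None = 0" for i
    using norm_diff_le_tuple_radius[of Y i] by (metis norm_le_zero_iff not_less order_trans)
  \<comment> \<open>If all differences vanish, any nonzero vector contradicts the kernel property;
    the all-ones vector is a convenient one.\<close>
  then have "(1 :: real ^ 'm) = 0"
    by (intro poised_imp_differences_ker[OF assms]) auto
  then show False by simp
qed

lemma L_hat_mult: "(L_hat Y *v w) $ i = (w \<bullet> (Y (Some i) - Y None)) / tuple_radius Y"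
  by (simp add: L_hat_def L_matrix_def matrix_vector_mult_def inner_vec_def sum_divide_distrib
      mult.commute)

text \<open>\<open>matrix_inv\<close> is defined by choice and inverts only an invertible matrix;
  for the square matrix \<open>L_hat Y\<close> a trivial kernel is enough.\<close>

lemma poised_L_hat_inverse:
  fixes Y :: "'m::finite option \<Rightarrow> real ^ 'm"
  assumes "poised Y"
  shows "matrix_inv (L_hat Y) *v (L_hat Y *v w) = w"
proof -
  have "\<forall>z. L_hat Y *v z = 0 \<longrightarrow> z = 0"
  proof clarify
    fix z assume "L_hat Y *v z = 0"
    then have "(L_hat Y *v z) $ i = 0" for i by simp
    then show "z = 0"
      using poised_tuple_radius_pos[OF assms]
      by (intro poised_imp_differences_ker[OF assms]) (auto simp: L_hat_mult)
  qed
  then have "invertible (L_hat Y)"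
    using matrix_left_invertible_ker invertible_left_inverse by blast
  then have "matrix_inv (L_hat Y) ** L_hat Y = mat 1"
    unfolding invertible_def matrix_inv_def by (rule someI2_ex) blast
  then show ?thesis by (simp add: matrix_vector_mul_assoc)
qed

text \<open>Let \<open>w\<close> be the error of the gradient. By interpolation, \<open>w\<close>
  applied to a difference is a Taylor remainder of \<open>h\<close>, at most K \<rho>^2 / 2. Hence
  every entry of \<open>L_hat Y *v w\<close> is at most K \<rho> / 2, its Euclidean norm costs a
  factor sqrt m, and inverting \<open>L_hat Y\<close> costs a factor \<open>M\<close>.\<close>

lemma linear_model_gradient_error:
  fixes Y :: "'m::finite option \<Rightarrow> real ^ 'm"
  assumes Y: "poised Y" and M: "spectral_norm (matrix_inv (L_hat Y)) \<le> M"
    and S: "cball (Y None) (tuple_radius Y) \<subseteq> S"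
    and h: "\<And>z. z \<in> S \<Longrightarrow> h differentiable (at z)"
    and lip: "K-lipschitz_on S (gradient h)"
  shows "norm (gradient (linear_model Y h) z - gradient h (Y None))
           \<le> K * (sqrt (real CARD('m)) * M / 2) * tuple_radius Y"
proof -
  define \<rho> where "\<rho> = tuple_radius Y"
  have \<rho>: "\<rho> > 0" unfolding \<rho>_def by (rule poised_tuple_radius_pos[OF Y])
  have K: "K \<ge> 0" by (rule lipschitz_on_nonneg[OF lip])
  obtain a c where ac: "\<And>i. a + c \<bullet> Y i = h (Y i)" and model: "linear_model Y h = (\<lambda>z. a + c \<bullet> z)"
    using poised_interpolant[OF Y] by blast
  define w where "w = c - gradient h (Y None)"
  have comp: "\<bar>(L_hat Y *v w) $ i\<bar> \<le> K * \<rho> / 2" for i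
  proof -
    have n: "norm (Y (Some i) - Y None) \<le> \<rho>"
      unfolding \<rho>_def by (rule norm_diff_le_tuple_radius)
    have sub: "cball (Y None) \<rho> \<subseteq> S" using S by (simp add: \<rho>_def)
    have "w \<bullet> (Y (Some i) - Y None)
        = h (Y (Some i)) - h (Y None) - gradient h (Y None) \<bullet> (Y (Some i) - Y None)"
      by (simp add: w_def inner_diff_left inner_diff_right flip: ac)
    also have "\<bar>\<dots>\<bar> \<le> K / 2 * (norm (Y (Some i) - Y None))\<^sup>2"
    proof (rule lipschitz_gradient_linearization[OF convex_cball])
      show "Y None \<in> cball (Y None) \<rho>" "Y (Some i) \<in> cball (Y None) \<rho>"
        using n \<rho> by (auto simp: dist_norm norm_minus_commute)
      show "K-lipschitz_on (cball (Y None) \<rho>) (gradient h)"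
        by (rule lipschitz_on_subset[OF lip sub])
      show "GDERIV h z :> gradient h z" if "z \<in> cball (Y None) \<rho>" for z
        using that sub by (intro GDERIV_gradient h) blast
    qed
    also have "\<dots> \<le> K / 2 * \<rho>\<^sup>2"
      using n K by (intro mult_left_mono power_mono) auto
    finally show ?thesis
      using \<rho> by (simp add: L_hat_mult \<rho>_def[symmetric] divide_le_eq power2_eq_square)
  qed
  have "norm (L_hat Y *v w) = L2_set (\<lambda>i. \<bar>(L_hat Y *v w) $ i\<bar>) UNIV"
    by (simp add: norm_vec_def)
  also have "\<dots> \<le> L2_set (\<lambda>i::'m. K * \<rho> / 2) UNIV"
    using comp by (intro L2_set_mono) auto
  also have "\<dots> = sqrt (real CARD('m)) * (K * \<rho> / 2)"
    using K \<rho> by (simp add: L2_set_constant)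
  finally have r: "norm (L_hat Y *v w) \<le> sqrt (real CARD('m)) * (K * \<rho> / 2)" .
  have "norm w = norm (matrix_inv (L_hat Y) *v (L_hat Y *v w))"
    by (simp add: poised_L_hat_inverse[OF Y])
  also have "\<dots> \<le> spectral_norm (matrix_inv (L_hat Y)) * norm (L_hat Y *v w)"
    unfolding spectral_norm_def by (rule onorm) simp
  also have "\<dots> \<le> M * (sqrt (real CARD('m)) * (K * \<rho> / 2))"
    using M r onorm_pos_le[OF matrix_vector_mul_bounded_linear, of "matrix_inv (L_hat Y)"]
    by (intro mult_mono) (auto simp: spectral_norm_def)
  finally show ?thesis
    by (simp add: model gradient_affine w_def \<rho>_def mult_ac)
qed

text \<open>The witness \<open>v\<close> applies the weights of \<open>V\<close> to the true
  gradients. Each active \<open>F t\<close> touches \<open>f\<close> from below at the centre, so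
  its gradient is a subgradient of \<open>f\<close>; the error bound is uniform in \<open>t\<close>
  and survives averaging.\<close>

lemma model_subgradient_error:
  fixes Y :: "'m::finite option \<Rightarrow> real ^ 'm"
  assumes f: "convex_on U f" and U': "open U'" "U' \<subseteq> U" "Y None \<in> U'"
    and rep: "lower_C2_representation U' f T F"
    and lip: "\<forall>t\<in>topspace T. K-lipschitz_on U' (gradient (F t))"
    and Y: "poised Y" "spectral_norm (matrix_inv (L_hat Y)) \<le> M"
      "cball (Y None) (tuple_radius Y) \<subseteq> U'"
    and V: "V \<in> model_subgradients T F Y (Y None)"
  obtains v where "v \<in> subdifferential U f (Y None)"
    "norm (V - v) \<le> K * (sqrt (real CARD('m)) * M / 2) * tuple_radius Y"
proof -
  define y where "y = Y None"
  obtain r \<tau> \<mu> where \<tau>: "\<And>i. i \<in> {1..r::nat} \<Longrightarrow> \<tau> i \<in> active_set T F y"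
    and \<mu>: "\<And>i. i \<in> {1..r} \<Longrightarrow> 0 \<le> \<mu> i" "sum \<mu> {1..r} = 1"
    and V_eq: "V = (\<Sum>i=1..r. \<mu> i *\<^sub>R gradient (linear_model Y (F (\<tau> i))) y)"
    using V unfolding model_subgradients_def y_def by blast
  define v where "v = (\<Sum>i=1..r. \<mu> i *\<^sub>R gradient (F (\<tau> i)) y)"
  have max: "\<And>z. z \<in> U' \<Longrightarrow> f z \<in> (\<lambda>t. F t z) ` topspace T"
    "\<And>z t. z \<in> U' \<Longrightarrow> t \<in> topspace T \<Longrightarrow> F t z \<le> f z"
    and diff: "\<And>z t. z \<in> U' \<Longrightarrow> t \<in> topspace T \<Longrightarrow> F t differentiable (at z)"
    using rep unfolding lower_C2_representation_def C2_on_def by auto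
  have y: "y \<in> U'" using U'(3) by (simp add: y_def)
  have active: "t \<in> topspace T" "F t y = f y" if t: "t \<in> active_set T F y" for t
  proof -
    show T: "t \<in> topspace T"
      using t by (auto simp: active_set_def is_arg_max_def)
    obtain s where "s \<in> topspace T" "F s y = f y" using max(1)[OF y] by auto
    then show "F t y = f y"
      using t max(2)[OF y T] by (force simp: active_set_def is_arg_max_def)
  qed
  have "gradient (F (\<tau> i)) y \<in> subdifferential U f y" if "i \<in> {1..r}" for i
  proof (rule gradient_minorant_in_subdifferential[OF f])
    note t = active[OF \<tau>[OF that]]
    show "GDERIV (F (\<tau> i)) y :> gradient (F (\<tau> i)) y"
      by (rule GDERIV_gradient[OF diff[OF y t(1)]])
    show "eventually (\<lambda>z. F (\<tau> i) z \<le> f z) (nhds y)"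
      using eventually_nhds_in_open[OF U'(1) y] by eventually_elim (rule max(2)[OF _ t(1)])
    show "F (\<tau> i) y = f y" by (rule t(2))
  qed (use y U'(2) in auto)
  then have "v \<in> subdifferential U f y"
    unfolding v_def using \<mu> by (intro convex_combination_in_subdifferential) auto
  moreover have "norm (V - v) \<le> K * (sqrt (real CARD('m)) * M / 2) * tuple_radius Y"
  proof -
    let ?e = "K * (sqrt (real CARD('m)) * M / 2) * tuple_radius Y"
    have "norm (V - v)
        = norm (\<Sum>i=1..r. \<mu> i *\<^sub>R (gradient (linear_model Y (F (\<tau> i))) y - gradient (F (\<tau> i)) y))"
      by (simp add: V_eq v_def scaleR_diff_right sum_subtractf)
    also have "\<dots> \<le> (\<Sum>i=1..r. \<mu> i * ?e)"
    proof (rule sum_norm_le)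
      fix i assume i: "i \<in> {1..r}"
      have "norm (gradient (linear_model Y (F (\<tau> i))) y - gradient (F (\<tau> i)) (Y None)) \<le> ?e"
        using active(1)[OF \<tau>[OF i]] lip diff
        by (intro linear_model_gradient_error[OF Y]) auto
      then show "norm (\<mu> i *\<^sub>R (gradient (linear_model Y (F (\<tau> i))) y - gradient (F (\<tau> i)) y))
          \<le> \<mu> i * ?e"
        using \<mu>(1)[OF i] unfolding norm_scaleR y_def by (intro mult_mono) auto
    qed
    also have "\<dots> = ?e" by (simp only: \<mu>(2) mult_1_left flip: sum_distrib_right)
    finally show ?thesis .
  qed
  ultimately show ?thesis using that by (simp add: y_def)
qed

section \<open>Bregman distances and the mirror step\<close>

lemma strongly_convex_imp_convex_on:
  assumes "strongly_convex_on U \<alpha> \<omega>" "\<alpha> \<ge> 0" "convex U"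
  shows "convex_on U \<omega>"
proof (rule convex_onI[OF _ assms(3)])
  fix t x y assume t: "0 < t" "t < (1::real)" and xy: "x \<in> U" "y \<in> U"
  have "\<omega> ((1 - t) *\<^sub>R x + (1 - (1 - t)) *\<^sub>R y)
      \<le> (1 - t) * \<omega> x + (1 - (1 - t)) * \<omega> y - \<alpha> / 2 * (1 - t) * (1 - (1 - t)) * (norm (x - y))\<^sup>2"
    using assms(1)[unfolded strongly_convex_on_def, rule_format, OF xy, of "1 - t"] t by simp
  moreover have "\<alpha> / 2 * (1 - t) * (1 - (1 - t)) * (norm (x - y))\<^sup>2 \<ge> 0"
    using t assms(2) by simp
  ultimately show "\<omega> ((1 - t) *\<^sub>R x + t *\<^sub>R y) \<le> (1 - t) * \<omega> x + t * \<omega> y" by simp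
qed

text \<open>Strong convexity on the segment from \<open>v\<close> to \<open>u\<close> bounds
  \<open>\<omega>\<close> by a quadratic in \<open>s\<close>; comparing slopes at s = 0 leaves its
  linear coefficient only.\<close>

lemma bregman_ge:
  fixes u v :: "'a::euclidean_space"
  assumes sc: "strongly_convex_on U \<alpha> \<omega>" and uv: "u \<in> U" "v \<in> U"
    and diff: "\<omega> differentiable (at v)"
  shows "\<alpha> / 2 * (norm (u - v))\<^sup>2 \<le> bregman \<omega> u v"
proof -
  let ?q = "\<alpha> / 2 * (norm (u - v))\<^sup>2"
  have "eventually (\<lambda>s. \<omega> (v + s *\<^sub>R (u - v)) \<le> \<omega> v + s * (\<omega> u - \<omega> v - ?q) + s\<^sup>2 * ?q) (at_right 0)"
    using eventually_at_right_in_unit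
  proof eventually_elim
    case (elim s)
    then have "\<omega> (s *\<^sub>R u + (1 - s) *\<^sub>R v)
        \<le> s * \<omega> u + (1 - s) * \<omega> v - \<alpha> / 2 * s * (1 - s) * (norm (u - v))\<^sup>2"
      using sc[unfolded strongly_convex_on_def, rule_format, OF uv, of s] by simp
    moreover have "s *\<^sub>R u + (1 - s) *\<^sub>R v = v + s *\<^sub>R (u - v)"
      by (simp add: algebra_simps)
    moreover have "s * \<omega> u + (1 - s) * \<omega> v - \<alpha> / 2 * s * (1 - s) * (norm (u - v))\<^sup>2
        = \<omega> v + s * (\<omega> u - \<omega> v - ?q) + s\<^sup>2 * ?q"
      by (simp add: field_simps power2_eq_square)
    ultimately show ?case by simp
  qed
  then have "gradient \<omega> v \<bullet> (u - v) \<le> \<omega> u - \<omega> v - ?q"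
    by (rule GDERIV_inner_le[OF GDERIV_gradient[OF diff]])
  then show ?thesis by (simp add: bregman_def)
qed

text \<open>The supremum is over a bounded set: gradients of the convex \<open>\<omega>\<close> are
  subgradients, hence bounded on the compact \<open>X\<close>.\<close>

lemma bregman_le_diameter:
  fixes U :: "'a::euclidean_space set"
  assumes "open U" "convex_on U \<omega>" "\<And>z. z \<in> U \<Longrightarrow> \<omega> differentiable (at z)"
    and "compact X" "X \<subseteq> U" and uv: "u \<in> X" "v \<in> X"
  shows "bregman \<omega> u v \<le> bregman_diameter \<omega> X"
proof -
  have cont: "continuous_on U \<omega>"
    using assms(3) by (auto intro!: continuous_at_imp_continuous_on differentiable_imp_continuous_within)
  obtain B where B: "\<And>x v. x \<in> X \<Longrightarrow> v \<in> subdifferential U \<omega> x \<Longrightarrow> norm v \<le> B"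
    using subdifferential_bounded_on_compact[OF assms(1) cont assms(4,5)] by blast
  have grad: "norm (gradient \<omega> z) \<le> B" if "z \<in> X" for z
  proof -
    have z: "z \<in> U" using that assms(5) by blast
    have "gradient \<omega> z \<in> subdifferential U \<omega> z"
      by (rule gradient_minorant_in_subdifferential[OF assms(2) z GDERIV_gradient[OF assms(3)[OF z]]])
        auto
    then show ?thesis by (rule B[OF that])
  qed
  have "bounded (\<omega> ` X)"
    by (intro compact_imp_bounded compact_continuous_image continuous_on_subset[OF cont] assms(4,5))
  then obtain W where W: "\<And>z. z \<in> X \<Longrightarrow> \<bar>\<omega> z\<bar> \<le> W"
    by (auto simp: bounded_iff)
  have "bregman \<omega> u v \<le> 2 * W + B * diameter X" if "u \<in> X" "v \<in> X" for u v
  proof -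
    have "- (gradient \<omega> v \<bullet> (u - v)) \<le> norm (gradient \<omega> v) * norm (u - v)"
      using Cauchy_Schwarz_ineq2[of "gradient \<omega> v" "u - v"] by linarith
    also have "\<dots> \<le> B * diameter X"
      using grad[OF that(2)] diameter_bounded_bound[OF compact_imp_bounded[OF assms(4)] that]
      by (intro mult_mono) (auto simp: dist_norm intro: order_trans[OF norm_ge_zero])
    finally show ?thesis using W[OF that(1)] W[OF that(2)] by (simp add: bregman_def)
  qed
  then show ?thesis
    unfolding bregman_diameter_def using uv
    by (intro cSup_upper) (auto intro!: bdd_aboveI[of _ "2 * W + B * diameter X"])
qed

text \<open>Optimality of \<open>y'\<close> and the three-point identity for Bregman distances
  handle d . (y' - u). The remaining d . (y - y') is split by Young's inequality, whose quadratic
  part is absorbed by \<open>bregman \<omega> y' y\<close> through strong convexity.\<close>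

lemma mirror_descent_step:
  fixes X :: "'a::euclidean_space set"
  assumes sc: "strongly_convex_on U \<alpha> \<omega>" and "\<alpha> > 0"
    and diff: "\<And>z. z \<in> U \<Longrightarrow> \<omega> differentiable (at z)"
    and X: "convex X" "X \<subseteq> U" "y \<in> X" "u \<in> X"
    and min: "is_arg_min (\<lambda>z. (d - gradient \<omega> y) \<bullet> z + \<omega> z) (\<lambda>z. z \<in> X) y'"
  shows "d \<bullet> (y - u) \<le> bregman \<omega> u y - bregman \<omega> u y' + (norm d)\<^sup>2 / (2 * \<alpha>)"
proof -
  let ?\<phi> = "\<lambda>z. (d - gradient \<omega> y) \<bullet> z + \<omega> z"
  have y': "y' \<in> X" and le: "\<And>z. z \<in> X \<Longrightarrow> ?\<phi> y' \<le> ?\<phi> z"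
    using min by (auto simp: is_arg_min_def not_less)
  have "GDERIV \<omega> y' :> gradient \<omega> y'"
    using X(2) y' by (intro GDERIV_gradient diff) auto
  \<comment> \<open>The slope comparison bounds derivatives from above, so minimality of
    \<open>y'\<close> is used as maximality for the negated objective.\<close>
  then have "GDERIV (\<lambda>z. - ?\<phi> z) y' :> - (d - gradient \<omega> y + gradient \<omega> y')"
    by (intro GDERIV_minus GDERIV_add) (auto simp: gderiv_def inner_commute intro!: derivative_eq_intros)
  moreover have "eventually (\<lambda>s. - ?\<phi> (y' + s *\<^sub>R (u - y')) \<le> - ?\<phi> y' + s * 0 + s\<^sup>2 * 0) (at_right 0)"
    using eventually_at_right_in_unit
  proof eventually_elim
    case (elim s)
    then have "y' + s *\<^sub>R (u - y') \<in> X"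
      using convexD_alt[OF X(1) y' X(4), of s] by (simp add: algebra_simps)
    from le[OF this] show ?case by simp
  qed
  ultimately have "- (d - gradient \<omega> y + gradient \<omega> y') \<bullet> (u - y') \<le> 0"
    by (rule GDERIV_inner_le)
  then have opt: "d \<bullet> (y' - u) \<le> bregman \<omega> u y - bregman \<omega> u y' - bregman \<omega> y' y"
    by (simp add: bregman_def inner_diff_left inner_diff_right inner_add_left)
  have "\<alpha> / 2 * (norm (y' - y))\<^sup>2 \<le> bregman \<omega> y' y"
    using X y' by (intro bregman_ge[OF sc] diff) auto
  moreover have "d \<bullet> (y - y') \<le> (norm d)\<^sup>2 / (2 * \<alpha>) + \<alpha> / 2 * (norm (y' - y))\<^sup>2"
  proof -
    have "0 \<le> (norm d - \<alpha> * norm (y' - y))\<^sup>2 / (2 * \<alpha>)" using \<open>\<alpha> > 0\<close> by simp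
    also have "\<dots> = (norm d)\<^sup>2 / (2 * \<alpha>) + \<alpha> / 2 * (norm (y' - y))\<^sup>2 - norm d * norm (y' - y)"
      using \<open>\<alpha> > 0\<close> by (simp add: power2_eq_square field_simps)
    finally show ?thesis
      using norm_cauchy_schwarz[of d "y - y'"] by (simp add: norm_minus_commute)
  qed
  moreover have "d \<bullet> (y - u) = d \<bullet> (y - y') + d \<bullet> (y' - u)"
    by (simp add: inner_diff_right)
  ultimately show ?thesis using opt by linarith
qed

section \<open>Sum estimates and the rate\<close>

lemma sum_inverse_sqrt_ge:
  assumes "1 \<le> s" "s \<le> Suc n"
  shows "2 * (sqrt (real (Suc n)) - sqrt (real s)) \<le> (\<Sum>k=s..n. 1 / sqrt (real k))"
proof -
  have "2 * (sqrt (real (Suc n)) - sqrt (real s)) = (\<Sum>k=s..n. 2 * (sqrt (real (Suc k)) - sqrt (real k)))"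
    using sum_Suc_diff[OF assms(2), of "\<lambda>k. sqrt (real k)"] by (simp only: flip: sum_distrib_left)
  also have "\<dots> \<le> (\<Sum>k=s..n. 1 / sqrt (real k))"
  proof (rule sum_mono)
    fix k assume k: "k \<in> {s..n}"
    then have "sqrt (real k) > 0" using assms(1) by simp
    \<comment> \<open>Expanding the square gives 2 sqrt (k (k + 1)) <= 2 k + 1, which is the tangent
      bound for the square root at \<open>k\<close>.\<close>
    moreover have "0 \<le> (sqrt (real (Suc k)) - sqrt (real k))\<^sup>2" by simp
    then have "2 * (sqrt (real (Suc k)) - sqrt (real k)) * sqrt (real k) \<le> 1"
      by (simp add: power2_diff left_diff_distrib right_diff_distrib mult.assoc)
    ultimately show "2 * (sqrt (real (Suc k)) - sqrt (real k)) \<le> 1 / sqrt (real k)"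
      by (simp add: pos_le_divide_eq)
  qed
  finally show ?thesis .
qed

text \<open>The induction step is 1 / (n + 1) <= ln ((n + 1) / n), which is ln z <= z - 1 at z = n /
  (n + 1). The first summand 1 / s is kept apart as the base case.\<close>

lemma sum_inverse_le_ln:
  assumes "1 \<le> s" "s \<le> n"
  shows "(\<Sum>k=s..n. 1 / real k) \<le> 1 / real s + ln (real n / real s)"
  using assms(2)
proof (induction n rule: dec_induct)
  case base
  then show ?case using assms(1) by simp
next
  case (step n)
  have "ln (real n / real (Suc n)) \<le> real n / real (Suc n) - 1"
    using step assms(1) by (intro ln_le_minus_one) auto
  also have "\<dots> = - 1 / real (Suc n)" by (simp add: field_simps)
  finally have "1 / real (Suc n) + ln (real n / real s) \<le> ln (real (Suc n) / real s)"
    using step assms(1) by (simp add: ln_div)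
  with step show ?case by simp
qed

lemma ln_2_ge_half: "1 / 2 \<le> ln (2::real)"
  using ln_le_minus_one[of "1 / 2 :: real"] by (simp add: ln_div)

text \<open>A purely numerical form of the argument: \<open>a k\<close> stands for the linearized
  gap, \<open>b k\<close> for the Bregman distance to the target and \<open>e k\<close> for the norm
  of the direction. If every \<open>a k\<close> with s <= k <= n exceeded the bound, the sum of t k
  * a k would be larger than \<Theta> (1 + ln 2), while the telescoped step inequality allows at
  most that.\<close>

lemma mirror_descent_rate:
  fixes a b e t :: "nat \<Rightarrow> real"
  assumes n: "n \<ge> 4" "n \<le> 2 * s" "2 * s \<le> n + 1"
    and pos: "\<Theta> > 0" "\<alpha> > 0" "N > 0"
    and e: "\<And>k. k \<ge> 1 \<Longrightarrow> 0 < e k \<and> e k \<le> 2 * N"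
    and t: "\<And>k. k \<ge> 1 \<Longrightarrow> t k = sqrt (\<Theta> * \<alpha>) / (e k * sqrt (real k))"
    and step: "\<And>k. k \<ge> 1 \<Longrightarrow> t k * a k \<le> b k - b (k + 1) + (t k * e k)\<^sup>2 / (2 * \<alpha>)"
    and b: "\<And>k. k \<ge> 1 \<Longrightarrow> 0 \<le> b k \<and> b k \<le> \<Theta>"
  obtains k where "s \<le> k" "k \<le> n"
    "a k \<le> 2 * sqrt (\<Theta> / \<alpha>) * N * ((1 + ln 2) / (2 - sqrt 2)) / sqrt (real n)"
proof (rule ccontr)
  let ?c = "(1 + ln 2) / (2 - sqrt 2) :: real"
  let ?R = "2 * sqrt (\<Theta> / \<alpha>) * N * ?c / sqrt (real n)"
  assume "\<not> thesis"
  with that have a: "?R < a k" if "k \<in> {s..n}" for k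
    using that not_less by (metis atLeastAtMost_iff)
  have sn: "2 \<le> s" "s \<le> n" using n by auto
  have "sqrt 2 < (2::real)" by (rule real_less_lsqrt) auto
  then have c: "0 \<le> ?c" "?c * (2 - sqrt 2) = 1 + ln 2"
    using ln_2_ge_half by auto
  have R: "?R \<ge> 0"
    using pos c(1) by (intro divide_nonneg_nonneg mult_nonneg_nonneg[OF _ c(1)]) auto
  have sqrts: "sqrt (\<Theta> * \<alpha>) * sqrt (\<Theta> / \<alpha>) = \<Theta>"
    using pos by (simp add: real_sqrt_mult real_sqrt_divide)
  \<comment> \<open>Since e k <= 2 N, the step \<open>t k\<close> is not too short: the factor 2 N
    cancels against the one in \<open>?R\<close>, and the two square roots combine to
    \<Theta>.\<close>
  have lower: "\<Theta> * ?c / sqrt (real n) * (1 / sqrt (real k)) < t k * a k" if k: "k \<in> {s..n}" for k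
  proof -
    have k1: "k \<ge> 1" using k sn by simp
    have "sqrt (\<Theta> * \<alpha>) / (2 * N * sqrt (real k)) \<le> t k"
      unfolding t[OF k1] using e[OF k1] k1 pos
      by (intro divide_left_mono mult_right_mono) auto
    then have "sqrt (\<Theta> * \<alpha>) / (2 * N * sqrt (real k)) * ?R \<le> t k * ?R"
      by (rule mult_right_mono[OF _ R])
    also have "\<dots> < t k * a k"
      using a[OF k] pos e[OF k1] k1 by (intro mult_strict_left_mono) (auto simp: t)
    also have "sqrt (\<Theta> * \<alpha>) / (2 * N * sqrt (real k)) * ?R
        = (sqrt (\<Theta> * \<alpha>) * sqrt (\<Theta> / \<alpha>)) * ?c / sqrt (real n) * (1 / sqrt (real k))"
      using pos(3) by (simp add: mult_ac)
    finally show ?thesis by (simp only: sqrts)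
  qed
  have "\<Theta> * (1 + ln 2) = \<Theta> * ?c / sqrt (real n) * ((2 - sqrt 2) * sqrt (real n))"
    using c(2) n(1) \<open>sqrt 2 < 2\<close> by simp
  also have "\<dots> \<le> \<Theta> * ?c / sqrt (real n) * (\<Sum>k=s..n. 1 / sqrt (real k))"
  proof (rule mult_left_mono)
    \<comment> \<open>From 2 s <= n + 1 follows 2 sqrt s <= sqrt 2 * sqrt (n + 1), so the telescoped
      bound leaves (2 - sqrt 2) sqrt (n + 1). This is the origin of the denominator of
      \<open>?c\<close>.\<close>
    have "sqrt 2 * sqrt (real s) \<le> sqrt (real (Suc n))"
      unfolding real_sqrt_mult[symmetric] using n by (intro real_sqrt_le_mono) linarith
    then have "sqrt 2 * (sqrt 2 * sqrt (real s)) \<le> sqrt 2 * sqrt (real (Suc n))"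
      by (rule mult_left_mono) simp
    then have "2 * sqrt (real s) \<le> sqrt 2 * sqrt (real (Suc n))"
      by (simp only: mult.assoc[symmetric] real_sqrt_mult_self abs_numeral)
    moreover have "(2 - sqrt 2) * sqrt (real n) \<le> (2 - sqrt 2) * sqrt (real (Suc n))"
      using \<open>sqrt 2 < 2\<close> by (intro mult_left_mono) auto
    moreover have "2 * (sqrt (real (Suc n)) - sqrt (real s)) \<le> (\<Sum>k=s..n. 1 / sqrt (real k))"
      using sn by (intro sum_inverse_sqrt_ge) auto
    ultimately show "(2 - sqrt 2) * sqrt (real n) \<le> (\<Sum>k=s..n. 1 / sqrt (real k))"
      by (simp add: algebra_simps)
  qed (use pos(1) in \<open>intro divide_nonneg_nonneg mult_nonneg_nonneg[OF _ c(1)]; simp\<close>)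
  also have "\<dots> = (\<Sum>k=s..n. \<Theta> * ?c / sqrt (real n) * (1 / sqrt (real k)))"
    by (rule sum_distrib_left)
  also have "\<dots> < (\<Sum>k=s..n. t k * a k)"
    using sn lower by (intro sum_strict_mono) auto
  also have "\<dots> \<le> (\<Sum>k=s..n. \<Theta> / 2 * (1 / real k) - (b (Suc k) - b k))"
  proof (rule sum_mono)
    fix k assume "k \<in> {s..n}"
    then have k1: "k \<ge> 1" using sn by simp
    \<comment> \<open>The normalization of the step cancels \<open>e k\<close>, so the quadratic
      terms form a harmonic sum whatever the directions are.\<close>
    then have "t k * e k = sqrt (\<Theta> * \<alpha>) / sqrt (real k)"
      using e[OF k1] by (simp add: t[OF k1])
    then have "(t k * e k)\<^sup>2 / (2 * \<alpha>) = \<Theta> / 2 * (1 / real k)"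
      using pos by (simp add: power_divide)
    with step[OF k1] show "t k * a k \<le> \<Theta> / 2 * (1 / real k) - (b (Suc k) - b k)" by simp
  qed
  also have "\<dots> = (\<Sum>k=s..n. \<Theta> / 2 * (1 / real k)) - (\<Sum>k=s..n. b (Suc k) - b k)"
    by (rule sum_subtractf)
  also have "\<dots> = b s - b (Suc n) + \<Theta> / 2 * (\<Sum>k=s..n. 1 / real k)"
    using sum_Suc_diff[of s n b] sn by (simp only: flip: sum_distrib_left)
  also have "\<dots> \<le> \<Theta> + \<Theta> / 2 * (2 * ln 2)"
  proof (intro add_mono mult_left_mono)
    show "b s - b (Suc n) \<le> \<Theta>" using b[of s] b[of "Suc n"] sn by simp
    \<comment> \<open>Here n >= 4 enters: it forces s >= 2, hence 1 / s <= 1 / 2 <= ln 2. The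
      logarithm is at most ln 2 because n <= 2 s.\<close>
    have "ln (real n / real s) \<le> ln 2"
      using n sn by (subst ln_le_cancel_iff) (auto simp: divide_le_eq)
    moreover have "1 / real s \<le> 1 / 2" using sn by (simp add: field_simps)
    ultimately show "(\<Sum>k=s..n. 1 / real k) \<le> 2 * ln 2"
      using sum_inverse_le_ln[of s n] ln_2_ge_half sn by linarith
  qed (use pos in simp)
  also have "\<dots> = \<Theta> * (1 + ln 2)" by (simp add: algebra_simps)
  finally show False by simp
qed

section \<open>The convergence estimate\<close>

theorem theorem4p3:
  fixes U U' X :: "(real ^ 'm::finite) set"
    and f g :: "real ^ 'm \<Rightarrow> real"
    and T\<^sub>f :: "'s topology" and F :: "'s \<Rightarrow> real ^ 'm \<Rightarrow> real"
    and T\<^sub>g :: "'t topology" and G :: "'t \<Rightarrow> real ^ 'm \<Rightarrow> real"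
    and K\<^sub>f K\<^sub>g \<alpha> \<epsilon> M :: real
    and \<omega> :: "real ^ 'm \<Rightarrow> real"
    and x :: "nat \<Rightarrow> real ^ 'm"
    and n :: nat
  assumes "U \<noteq> {}" "open U" "convex U"
    and "continuous_on U f" "convex_on U f"
    and "continuous_on U g" "convex_on U g"
    and "X \<subseteq> U" "X \<noteq> {}" "compact X" "convex X" "\<nexists>a. X = {a}"
    and "optimal_solutions X f g \<noteq> {}"
    and "open U'" "X \<subseteq> U'" "U' \<subseteq> U"
    and "lower_C2_representation U' f T\<^sub>f F"
    and "lower_C2_representation U' g T\<^sub>g G"
    and "K\<^sub>f \<ge> 0" "\<forall>t\<in>topspace T\<^sub>f. K\<^sub>f-lipschitz_on U' (gradient (F t))"
    and "K\<^sub>g \<ge> 0" "\<forall>t\<in>topspace T\<^sub>g. K\<^sub>g-lipschitz_on U' (gradient (G t))"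
    and "\<forall>z\<in>U. \<omega> differentiable (at z)" "\<alpha> > 0" "strongly_convex_on U \<alpha> \<omega>"
    and "\<epsilon> > 0" "M > 0"
    and "comirror_sequence U' X g T\<^sub>f F T\<^sub>g G \<omega> \<alpha> \<epsilon> M x"
    and "n \<ge> 4"
  shows
    "let \<Theta> = bregman_diameter \<omega> X;
         \<kappa>\<^sub>1 = max (subgradient_bound U X f) (subgradient_bound U X g);
         K = max K\<^sub>f K\<^sub>g;
         \<kappa>\<^sub>2 = K * (1 + sqrt (real CARD('m)) * M / 2);
         \<Omega> = diameter X;
         C = 2 * sqrt (\<Theta> / \<alpha>) * max \<kappa>\<^sub>1 \<kappa>\<^sub>2 * ((1 + ln 2) / (2 - sqrt 2)) + sqrt 2 * \<kappa>\<^sub>2 * \<Omega>;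
         I = {k \<in> {1..n}. g (x k) \<le> \<epsilon>}
     in min (INF k\<in>I. ereal (f (x k) - optimal_value X f g)) (ereal \<epsilon>) \<le> ereal (C / sqrt (real n))"
proof -
  note U = assms(2,3) and f = assms(4,5) and g = assms(6,7)
    and XU = assms(8) and X = assms(9-12) and U' = assms(14-16)
    and diff = assms(23)[rule_format] and \<alpha> = assms(24) and sc = assms(25)
    and \<epsilon> = assms(26) and M = assms(27) and n = assms(29)
  define \<Theta> where "\<Theta> = bregman_diameter \<omega> X"
  define \<kappa>\<^sub>1 where "\<kappa>\<^sub>1 = max (subgradient_bound U X f) (subgradient_bound U X g)"
  define K where "K = max K\<^sub>f K\<^sub>g"
  define \<kappa>\<^sub>2 where "\<kappa>\<^sub>2 = K * (1 + sqrt (real CARD('m)) * M / 2)"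
  define \<Omega> where "\<Omega> = diameter X"
  define N where "N = max \<kappa>\<^sub>1 \<kappa>\<^sub>2"
  define R where "R = 2 * sqrt (\<Theta> / \<alpha>) * N * ((1 + ln 2) / (2 - sqrt 2)) / sqrt (real n)"
  \<comment> \<open>This is n / 2 rounded up, so that n <= 2 s <= n + 1 for either parity of
    \<open>n\<close>.\<close>
  define s where "s = (n + 1) div 2"
  have K: "K \<ge> 0" "K\<^sub>f \<le> K" "K\<^sub>g \<le> K" using assms(19) by (auto simp: K_def)
  have \<kappa>\<^sub>2: "\<kappa>\<^sub>2 \<ge> 0" using K M by (simp add: \<kappa>\<^sub>2_def)

  have xX: "x k \<in> X" if "k \<ge> 1" for k
    using assms(28) that by (simp add: comirror_sequence_def)
  obtain \<Delta> :: "nat \<Rightarrow> real" and Y :: "nat \<Rightarrow> 'm option \<Rightarrow> real ^ 'm" and E :: "nat \<Rightarrow> real ^ 'm"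
    where alg: "\<And>k. k \<ge> 1 \<Longrightarrow>
          0 < \<Delta> k \<and> \<Delta> k \<le> 1 / sqrt (real k + 1) \<and>
          poised (Y k) \<and> Y k None = x k \<and> range (Y k) \<subseteq> cball (x k) (\<Delta> k) \<and>
          spectral_norm (matrix_inv (L_hat (Y k))) \<le> M \<and>
          cball (x k) (tuple_radius (Y k)) \<subseteq> U' \<and>
          E k \<in> (if g (x k) \<le> \<epsilon> then model_subgradients T\<^sub>f F (Y k) (x k)
                 else model_subgradients T\<^sub>g G (Y k) (x k)) \<and>
          E k \<noteq> 0 \<and>
          (let t = sqrt (bregman_diameter \<omega> X * \<alpha>) / (norm (E k) * sqrt (real k))
           in is_arg_min (\<lambda>z. (t *\<^sub>R E k - gradient \<omega> (x k)) \<bullet> z + \<omega> z) (\<lambda>z. z \<in> X)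
                (x (k + 1)))"
    using assms(28) unfolding comirror_sequence_def by blast
  define t where "t k = sqrt (\<Theta> * \<alpha>) / (norm (E k) * sqrt (real k))" for k

  obtain u where u: "u \<in> X" "g u \<le> 0" and f_u: "\<And>z. z \<in> feasible_set X g \<Longrightarrow> f u \<le> f z"
    using assms(13) by (force simp: optimal_solutions_def is_arg_min_def feasible_set_def not_less)
  have opt: "optimal_value X f g = f u"
    unfolding optimal_value_def using u f_u by (intro cInf_eq_minimum) (auto simp: feasible_set_def)

  have breg_le: "bregman \<omega> y z \<le> \<Theta>" if "y \<in> X" "z \<in> X" for y z
    unfolding \<Theta>_def using U \<alpha> diff X XU that
    by (intro bregman_le_diameter[of U] strongly_convex_imp_convex_on[OF sc]) auto
  have breg_ge: "\<alpha> / 2 * (norm (y - z))\<^sup>2 \<le> bregman \<omega> y z" if "y \<in> X" "z \<in> X" for y z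
    using XU that by (intro bregman_ge[OF sc] diff) auto
  \<comment> \<open>Two distinct points of \<open>X\<close> make \<Theta> positive, and with it all
    step lengths.\<close>
  obtain p q where "p \<in> X" "q \<in> X" "p \<noteq> q" using X(1,4) by blast
  with breg_ge[of p q] breg_le[of p q] \<alpha> have \<Theta>: "\<Theta> > 0"
    by (smt (verit) mult_pos_pos half_gt_zero zero_less_norm_iff zero_less_power right_minus_eq)

  have "\<exists>v. v \<in> subdifferential U (if g (x k) \<le> \<epsilon> then f else g) (x k) \<and>
        norm (E k - v) \<le> \<kappa>\<^sub>2 / sqrt (real k + 1)" if k: "k \<ge> 1" for k
  proof -
    note A = alg[OF k]
    have rad: "tuple_radius (Y k) \<le> 1 / sqrt (real k + 1)"
      unfolding tuple_radius_def
    proof (subst Max_le_iff)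
      have "norm (Y k (Some i) - Y k None) \<le> \<Delta> k" for i
      proof -
        have "Y k (Some i) \<in> cball (x k) (\<Delta> k)" using A by blast
        then show ?thesis using A by (simp add: dist_norm norm_minus_commute)
      qed
      then show "\<forall>r\<in>range (\<lambda>i. norm (Y k (Some i) - Y k None)). r \<le> 1 / sqrt (real k + 1)"
        using A by (force intro: order_trans)
    qed auto
    \<comment> \<open>A common bound for both representations, with \<open>K'\<close> being
      \<open>K\<^sub>f\<close> or \<open>K\<^sub>g\<close>.\<close>
    have weaken: "norm w \<le> \<kappa>\<^sub>2 / sqrt (real k + 1)"
      if "norm w \<le> K' * (sqrt (real CARD('m)) * M / 2) * tuple_radius (Y k)" "K' \<le> K" for w :: "real ^ 'm" and K'
    proof -
      have "K' * (sqrt (real CARD('m)) * M / 2) \<le> \<kappa>\<^sub>2"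
        unfolding \<kappa>\<^sub>2_def using that(2) K M by (intro mult_mono) auto
      moreover have "tuple_radius (Y k) > 0" using A by (intro poised_tuple_radius_pos) auto
      ultimately have "K' * (sqrt (real CARD('m)) * M / 2) * tuple_radius (Y k)
          \<le> \<kappa>\<^sub>2 * (1 / sqrt (real k + 1))"
        using rad \<kappa>\<^sub>2 by (intro mult_mono) auto
      from order_trans[OF that(1) this] show ?thesis by simp
    qed
    have Yk: "poised (Y k)" "spectral_norm (matrix_inv (L_hat (Y k))) \<le> M"
      "cball (Y k None) (tuple_radius (Y k)) \<subseteq> U'"
      using A by auto
    have xU': "Y k None \<in> U'" using A xX[OF k] U'(2) by auto
    show ?thesis
    proof (cases "g (x k) \<le> \<epsilon>")
      case True
      with A have "E k \<in> model_subgradients T\<^sub>f F (Y k) (Y k None)" by simp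
      then obtain v where "v \<in> subdifferential U f (Y k None)"
        "norm (E k - v) \<le> K\<^sub>f * (sqrt (real CARD('m)) * M / 2) * tuple_radius (Y k)"
        by (rule model_subgradient_error[where Y = "Y k", OF f(2) U'(1,3) xU' assms(17,20) Yk])
      with A True weaken[OF _ K(2)] show ?thesis by auto
    next
      case False
      with A have "E k \<in> model_subgradients T\<^sub>g G (Y k) (Y k None)" by simp
      then obtain v where "v \<in> subdifferential U g (Y k None)"
        "norm (E k - v) \<le> K\<^sub>g * (sqrt (real CARD('m)) * M / 2) * tuple_radius (Y k)"
        by (rule model_subgradient_error[where Y = "Y k", OF g(2) U'(1,3) xU' assms(18,22) Yk])
      with A False weaken[OF _ K(3)] show ?thesis by auto
    qed
  qed
  then obtain v where
    v: "\<And>k. k \<ge> 1 \<Longrightarrow> v k \<in> subdifferential U (if g (x k) \<le> \<epsilon> then f else g) (x k)"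
    and v_err: "\<And>k. k \<ge> 1 \<Longrightarrow> norm (E k - v k) \<le> \<kappa>\<^sub>2 / sqrt (real k + 1)"
    by metis

  \<comment> \<open>The bound is |E k| <= \<kappa>_1 + \<kappa>_2 <= 2 max \<kappa>_1 \<kappa>_2,
    which is where the leading 2 in the constant comes from.\<close>
  have E: "0 < norm (E k) \<and> norm (E k) \<le> 2 * N" if k: "k \<ge> 1" for k
  proof -
    have "norm (v k) \<le> subgradient_bound U X (if g (x k) \<le> \<epsilon> then f else g)"
      using U f g X XU xX[OF k] v[OF k] by (intro norm_le_subgradient_bound) auto
    then have "norm (v k) \<le> \<kappa>\<^sub>1" by (auto simp: \<kappa>\<^sub>1_def split: if_splits)
    moreover have "\<kappa>\<^sub>2 / sqrt (real k + 1) \<le> \<kappa>\<^sub>2" using \<kappa>\<^sub>2 by (simp add: divide_le_eq mult_le_cancel_left1)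
    moreover have "norm (E k) \<le> norm (v k) + norm (E k - v k)" by norm
    ultimately show ?thesis using v_err[OF k] alg[OF k] by (simp add: N_def)
  qed

  obtain k where k: "s \<le> k" "k \<le> n" and gap: "E k \<bullet> (x k - u) \<le> R"
    unfolding R_def
  proof (rule mirror_descent_rate[where n = n and s = s and \<Theta> = \<Theta> and \<alpha> = \<alpha> and N = N
        and e = "\<lambda>k. norm (E k)" and t = t and b = "\<lambda>k. bregman \<omega> u (x k)"
        and a = "\<lambda>k. E k \<bullet> (x k - u)"])
    \<comment> \<open>The first direction is nonzero, which excludes the degenerate case of a zero
      bound.\<close>
    show "N > 0" using E[of 1] by linarith
    fix k :: nat assume k: "k \<ge> 1"
    have "(t k *\<^sub>R E k) \<bullet> (x k - u)
        \<le> bregman \<omega> u (x k) - bregman \<omega> u (x (k + 1)) + (norm (t k *\<^sub>R E k))\<^sup>2 / (2 * \<alpha>)"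
      using alg[OF k] xX[OF k] u(1) X XU
      by (intro mirror_descent_step[OF sc \<alpha> diff]) (auto simp: t_def \<Theta>_def Let_def)
    then show "t k * (E k \<bullet> (x k - u))
        \<le> bregman \<omega> u (x k) - bregman \<omega> u (x (k + 1)) + (t k * norm (E k))\<^sup>2 / (2 * \<alpha>)"
      by (simp add: power_mult_distrib)
    have "0 \<le> \<alpha> / 2 * (norm (u - x k))\<^sup>2" using \<alpha> by simp
    then show "0 \<le> bregman \<omega> u (x k) \<and> bregman \<omega> u (x k) \<le> \<Theta>"
      using breg_le[OF u(1) xX[OF k]] breg_ge[OF u(1) xX[OF k]] by linarith
  qed (use n \<Theta> \<alpha> E that in \<open>auto simp: s_def t_def\<close>)

  have k1: "k \<ge> 1" using k(1) n by (simp add: s_def)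
  \<comment> \<open>Replacing \<open>E k\<close> by the true subgradient costs at most \<kappa>_2 /
    sqrt (k + 1) times the diameter; as k >= n / 2, this is the second term of the constant.\<close>
  have "v k \<bullet> (x k - u) \<le> R + sqrt 2 * \<kappa>\<^sub>2 * \<Omega> / sqrt (real n)"
  proof -
    have "v k \<bullet> (x k - u) = E k \<bullet> (x k - u) + (v k - E k) \<bullet> (x k - u)"
      by (simp add: inner_diff_left)
    moreover have "(v k - E k) \<bullet> (x k - u) \<le> norm (E k - v k) * norm (x k - u)"
      using norm_cauchy_schwarz[of "v k - E k"] by (simp add: norm_minus_commute[of "E k"])
    moreover have "norm (E k - v k) * norm (x k - u) \<le> sqrt 2 * \<kappa>\<^sub>2 / sqrt (real n) * \<Omega>"
    proof (rule mult_mono)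
      have "sqrt (real n) \<le> sqrt (2 * (real k + 1))"
        using k(1) by (intro real_sqrt_le_mono) (simp add: s_def)
      then have "sqrt (real n) \<le> sqrt 2 * sqrt (real k + 1)" by (simp only: real_sqrt_mult)
      then have "\<kappa>\<^sub>2 * sqrt (real n) \<le> \<kappa>\<^sub>2 * (sqrt 2 * sqrt (real k + 1))"
        by (rule mult_left_mono[OF _ \<kappa>\<^sub>2])
      then have "\<kappa>\<^sub>2 / sqrt (real k + 1) \<le> sqrt 2 * \<kappa>\<^sub>2 / sqrt (real n)"
        using n by (simp add: field_simps)
      with v_err[OF k1] show "norm (E k - v k) \<le> sqrt 2 * \<kappa>\<^sub>2 / sqrt (real n)" by simp
      show "norm (x k - u) \<le> \<Omega>"
        unfolding \<Omega>_def using diameter_bounded_bound[OF compact_imp_bounded[OF X(2)] xX[OF k1] u(1)]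
        by (simp add: dist_norm)
    qed (use \<kappa>\<^sub>2 in auto)
    ultimately show ?thesis using gap by (simp add: mult.commute)
  qed
  then have bound: "v k \<bullet> (x k - u)
      \<le> (2 * sqrt (\<Theta> / \<alpha>) * N * ((1 + ln 2) / (2 - sqrt 2)) + sqrt 2 * \<kappa>\<^sub>2 * \<Omega>) / sqrt (real n)"
    (is "_ \<le> ?C / _") by (simp add: R_def add_divide_distrib)

  \<comment> \<open>In the second case the index set may be empty; the infimum in
    \<open>ereal\<close> is then infinite, and the minimum is attained by \<epsilon>.\<close>
  have "min (INF k\<in>{k \<in> {1..n}. g (x k) \<le> \<epsilon>}. ereal (f (x k) - f u)) (ereal \<epsilon>) \<le> ereal (?C / sqrt (real n))"
  proof (cases "g (x k) \<le> \<epsilon>")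
    case True
    with v[OF k1] u XU have "f u \<ge> f (x k) + v k \<bullet> (u - x k)"
      by (auto simp: subdifferential_def)
    with bound have "f (x k) - f u \<le> ?C / sqrt (real n)" by (simp add: inner_diff_right)
    then have "(INF k\<in>{k \<in> {1..n}. g (x k) \<le> \<epsilon>}. ereal (f (x k) - f u)) \<le> ereal (?C / sqrt (real n))"
      using k k1 True by (intro INF_lower2[of k]) auto
    then show ?thesis by (rule min.coboundedI1)
  next
    case False
    with v[OF k1] u XU have "g u \<ge> g (x k) + v k \<bullet> (u - x k)"
      by (auto simp: subdifferential_def)
    with False u(2) bound have "\<epsilon> \<le> ?C / sqrt (real n)" by (simp add: inner_diff_right)
    then show ?thesis by (intro min.coboundedI2) simp
  qed
  then show ?thesis
    unfolding Let_def opt by (simp only: \<Theta>_def \<kappa>\<^sub>1_def \<kappa>\<^sub>2_def K_def \<Omega>_def N_def)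
qed

end
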